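(* Let $a<b$ be real numbers, let $1<p<\infty$, and let $q$ satisfy $\frac1p+\frac1q=1$. Let $f:[a,b]\times\mathbb{R}\to\mathbb{R}$ satisfy the Carathéodory conditions, let $k:[a,b]\times[a,b]\to\mathbb{R}$, and let $g$ be a function on $[a,b]\times\mathbb{R}$. Assume: (A1) There are a non-negative function $h_1\in L^p([a,b])$ and a constant $b_1\ge 0$ such that $|f(t,x)|\le h_1(t)+b_1|x|^{q/p}$ for a.e. $t\in[a,b]$ and all $x\in\mathbb{R}$. (A2) For all $t\in[a,b]$, $k(t,\cdot)$ is measurable and belongs to $L^q([a,b])$, and $\left(\int_a^b|k(t,s)|^q\,ds\right)^{1/q}\le M_1(t)$ for any $t\in[a,b]$, where $M_1$ is a non-negative function in $L^p([a,b])$. (A3) $g$ is a map from $[a,b]\times\mathbb{R}$ into $[a,b]$ satisfying the Carathéodory conditions and such that $|g(s,z)|\le a_0(s)+b_0|z|$ for $s\in[a,b]$, $z\in\mathbb{R}$, where $a_0$ is a non-negative function in $L^p([a,b])$ and $b_0\ge0$ is a constant. (H1) There is $M>0$ such that $|f(t,x_1)-f(t,x_2)|\le M|x_1-x_2|$ for any $t\in[a,b]$ and $x_1,x_2\in\mathbb{R}$. (H2) There is $L>0$ such that $|g(s,z_1)-g(s,z_2)|\le L|z_1-z_2|$ for any $s\in[a,b]$ and $z_1,z_2\in\mathbb{R}$. Put $C=ML$ and assume moreover that $\int_a^b C^p[M_1(s)]^p\,ds<1$. Then the equation $$y(t)=f\left(t,\int_a^b k(t,s)\,g(s,y(s))\,ds\right),\qquad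 t\in[a,b],$$ has a unique solution in $L^p([a,b])$, and this solution can be obtained as the limit in $L^p([a,b])$ of the successive approximations given by $y_0(t)=0$ and $$y_{n+1}(t)=f\left(t,\int_a^b k(t,s)\,g(s,y_n(s))\,ds\right),\qquad n=0,1,2,\dots$$
   Context: A function $\varphi:[a,b]\times\mathbb{R}\to\mathbb{R}$ satisfies the Carathéodory conditions if: (i) $\varphi(t,x)$ is continuous in $x$ for each fixed $t$; (ii) $\varphi(t,x)$ is measurable in $t$ for each fixed $x$; (iii) there is a non-negative Lebesgue-integrable function $m:[a,b]\to\mathbb{R}$ such that $|\varphi(t,x)|\le m(t)$ for all $(t,x)\in[a,b]\times\mathbb{R}$. Functions are real-valued and $L^p([a,b])$ is taken with respect to Lebesgue measure. A solution in $L^p([a,b])$ is a $y\in L^p([a,b])$ satisfying the equation (as an identity of elements of $L^p([a,b])$).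
   Formalization: The kernel k is additionally assumed jointly Lebesgue measurable on [a,b]×[a,b]; without this the claim fails, e.g. k(t,s)=1_N(t) with N non-measurable, f(t,x)=min(|x|,1), g=1 on [0,1]. *)

theory Defs
  imports "HOL-Analysis.Analysis"
begin

text \<open>
  Elements of \<open>L\<^sup>p([a,b])\<close> are represented by functions on the real line whose values outside
  \<open>[a,b]\<close> are irrelevant; equality in \<open>L\<^sup>p([a,b])\<close> is equality almost everywhere on \<open>[a,b]\<close>.
\<close>

definition Lp :: "real \<Rightarrow> real \<Rightarrow> real \<Rightarrow> (real \<Rightarrow> real) set" where
  "Lp p a b =
     {y. y \<in> borel_measurable (lebesgue_on {a..b}) \<and>
         integrable (lebesgue_on {a..b}) (\<lambda>t. \<bar>y t\<bar> powr p)}"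

definition Lp_norm :: "real \<Rightarrow> real \<Rightarrow> real \<Rightarrow> (real \<Rightarrow> real) \<Rightarrow> real" where
  "Lp_norm p a b y = (LINT t|lebesgue_on {a..b}. \<bar>y t\<bar> powr p) powr (1 / p)"

definition caratheodory :: "real \<Rightarrow> real \<Rightarrow> (real \<Rightarrow> real \<Rightarrow> real) \<Rightarrow> bool" where
  "caratheodory a b \<phi> \<longleftrightarrow>
     (\<forall>t\<in>{a..b}. continuous_on UNIV (\<lambda>x. \<phi> t x)) \<and>
     (\<forall>x. (\<lambda>t. \<phi> t x) \<in> borel_measurable (lebesgue_on {a..b})) \<and>
     (\<exists>m. (\<forall>t\<in>{a..b}. 0 \<le> m t) \<and> integrable (lebesgue_on {a..b}) m \<and>
          (\<forall>t\<in>{a..b}. \<forall>x. \<bar>\<phi> t x\<bar> \<le> m t))"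

definition rhs_op ::
  "real \<Rightarrow> real \<Rightarrow> (real \<Rightarrow> real \<Rightarrow> real) \<Rightarrow> (real \<Rightarrow> real \<Rightarrow> real) \<Rightarrow> (real \<Rightarrow> real \<Rightarrow> real)
    \<Rightarrow> (real \<Rightarrow> real) \<Rightarrow> real \<Rightarrow> real" where
  "rhs_op a b f k g y = (\<lambda>t. f t (LINT s|lebesgue_on {a..b}. k t s * g s (y s)))"

definition Lp_solution ::
  "real \<Rightarrow> real \<Rightarrow> real \<Rightarrow> (real \<Rightarrow> real \<Rightarrow> real) \<Rightarrow> (real \<Rightarrow> real \<Rightarrow> real) \<Rightarrow> (real \<Rightarrow> real \<Rightarrow> real)
    \<Rightarrow> (real \<Rightarrow> real) \<Rightarrow> bool" where
  "Lp_solution p a b f k g y \<longleftrightarrow>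
     y \<in> Lp p a b \<and> (AE t in lebesgue_on {a..b}. y t = rhs_op a b f k g y t)"

primrec successive_approx ::
  "real \<Rightarrow> real \<Rightarrow> (real \<Rightarrow> real \<Rightarrow> real) \<Rightarrow> (real \<Rightarrow> real \<Rightarrow> real) \<Rightarrow> (real \<Rightarrow> real \<Rightarrow> real)
    \<Rightarrow> nat \<Rightarrow> real \<Rightarrow> real" where
  "successive_approx a b f k g 0 = (\<lambda>t. 0)"
| "successive_approx a b f k g (Suc n) = rhs_op a b f k g (successive_approx a b f k g n)"

end

theory Submission
  imports Defs
begin

text \<open>
  Write \<open>T y\<close> for the right-hand side of the equation and \<open>\<parallel>\<cdot>\<parallel>\<close> for the norm of \<open>L\<^sup>p\<close>. The Lipschitz
  conditions on \<open>f\<close> and \<open>g\<close>, together with Hoelder's inequality for the integral against \<open>k t\<close>,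
  give for every \<open>t\<close>
    \<open>\<bar>T y t - T z t\<bar> \<le> M \<bar>\<integral> k t s (g s (y s) - g s (z s)) ds\<bar> \<le> C M1(t) \<parallel>y - z\<parallel>\<close>.
  Taking norms in \<open>t\<close>, the operator \<open>T\<close> contracts by the factor \<open>c = \<parallel>C M1\<parallel>\<close>, and \<open>c < 1\<close> is what the
  hypothesis on the integral of \<open>C\<^sup>p M1\<^sup>p\<close> says.

  Since the estimate holds at each point, consecutive approximations differ at \<open>t\<close>, from \<open>y\<^sub>1\<close> on,
  by at most a constant times \<open>M1(t) c\<^sup>n\<close>. The solution is their pointwise limit, and the geometric
  tails, multiplied by \<open>M1 \<in> L\<^sup>p\<close>, bound the error in norm (\<open>Lp_fixed_point\<close>). Uniqueness is the
  usual \<open>\<parallel>z - y\<parallel> \<le> c \<parallel>z - y\<parallel>\<close>.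

  That \<open>T\<close> maps \<open>L\<^sup>p\<close> to itself needs measurability twice: superposition with a Caratheodory
  function preserves it (\<open>caratheodory_measurable_compose\<close>), and so does integration against a
  kernel that is Lebesgue measurable on the square (\<open>borel_measurable_kernel_integral\<close>).
\<close>

section \<open>The spaces of p-th power integrable functions\<close>

lemma Lp_measurable: "u \<in> Lp p a b \<Longrightarrow> u \<in> borel_measurable (lebesgue_on {a..b})"
  by (simp add: Lp_def)

lemma Lp_norm_nonneg [simp]: "0 \<le> Lp_norm p a b u"
  by (simp add: Lp_norm_def)

lemma Lp_zero [simp]: "(\<lambda>t. 0) \<in> Lp p a b"
  by (simp add: Lp_def)

lemma Lp_dominated:
  assumes v: "v \<in> Lp p a b" and p: "0 < p" and A: "0 \<le> A"
    and u: "u \<in> borel_measurable (lebesgue_on {a..b})"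
    and le: "AE t in lebesgue_on {a..b}. \<bar>u t\<bar> \<le> A * \<bar>v t\<bar>"
  shows "u \<in> Lp p a b" and "Lp_norm p a b u \<le> A * Lp_norm p a b v"
proof -
  have vi: "integrable (lebesgue_on {a..b}) (\<lambda>t. A powr p * \<bar>v t\<bar> powr p)"
    using v by (simp add: Lp_def)
  have le': "AE t in lebesgue_on {a..b}. \<bar>u t\<bar> powr p \<le> A powr p * \<bar>v t\<bar> powr p"
    using le
  proof eventually_elim
    case (elim t)
    have "\<bar>u t\<bar> powr p \<le> (A * \<bar>v t\<bar>) powr p"
      using elim p by (intro powr_mono2) auto
    then show ?case using A by (simp add: powr_mult)
  qed
  have ui: "integrable (lebesgue_on {a..b}) (\<lambda>t. \<bar>u t\<bar> powr p)"
    by (rule Bochner_Integration.integrable_bound[OF vi]) (use u le' in auto)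
  then show "u \<in> Lp p a b" using u by (simp add: Lp_def)
  have "(LINT t|lebesgue_on {a..b}. \<bar>u t\<bar> powr p)
      \<le> (LINT t|lebesgue_on {a..b}. A powr p * \<bar>v t\<bar> powr p)"
    by (rule integral_mono_AE[OF ui vi le'])
  then have "Lp_norm p a b u \<le> (A powr p * (LINT t|lebesgue_on {a..b}. \<bar>v t\<bar> powr p)) powr (1 / p)"
    unfolding Lp_norm_def using p by (intro powr_mono2) auto
  also have "\<dots> = A * Lp_norm p a b v"
    using p A by (simp add: Lp_norm_def powr_mult powr_powr)
  finally show "Lp_norm p a b u \<le> A * Lp_norm p a b v" .
qed

lemma Lp_scale:
  assumes "v \<in> Lp p a b" "0 < p"
  shows "(\<lambda>t. A * v t) \<in> Lp p a b"
  by (rule Lp_dominated(1)[OF assms, of "\<bar>A\<bar>"])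
    (use Lp_measurable[OF assms(1)] in \<open>auto simp: abs_mult\<close>)

lemma Lp_abs:
  assumes "v \<in> Lp p a b"
  shows "(\<lambda>t. \<bar>v t\<bar>) \<in> Lp p a b"
  using assms by (auto simp: Lp_def)

text \<open>
  By \<open>\<bar>x + y\<bar> \<le> 2 max(\<bar>x\<bar>, \<bar>y\<bar>)\<close>, the integrand is at most \<open>2\<^sup>p (\<bar>x\<bar>\<^sup>p + \<bar>y\<bar>\<^sup>p)\<close>, for every
  \<open>p > 0\<close>.
\<close>

lemma Lp_add:
  assumes u: "u \<in> Lp p a b" and v: "v \<in> Lp p a b" and p: "0 < p"
  shows "(\<lambda>t. u t + v t) \<in> Lp p a b"
proof -
  have m: "u \<in> borel_measurable (lebesgue_on {a..b})" "v \<in> borel_measurable (lebesgue_on {a..b})"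
    using u v by (auto dest: Lp_measurable)
  have i: "integrable (lebesgue_on {a..b}) (\<lambda>t. 2 powr p * (\<bar>u t\<bar> powr p + \<bar>v t\<bar> powr p))"
    using u v by (auto simp: Lp_def)
  have le: "\<bar>u t + v t\<bar> powr p \<le> 2 powr p * (\<bar>u t\<bar> powr p + \<bar>v t\<bar> powr p)" for t
  proof -
    have "\<bar>u t + v t\<bar> powr p \<le> (2 * max \<bar>u t\<bar> \<bar>v t\<bar>) powr p"
      using p by (intro powr_mono2) auto
    also have "\<dots> = 2 powr p * max \<bar>u t\<bar> \<bar>v t\<bar> powr p"
      by (simp add: powr_mult)
    also have "\<dots> \<le> 2 powr p * (\<bar>u t\<bar> powr p + \<bar>v t\<bar> powr p)"
      by (intro mult_left_mono) (auto simp: max_def)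
    finally show ?thesis .
  qed
  have "integrable (lebesgue_on {a..b}) (\<lambda>t. \<bar>u t + v t\<bar> powr p)"
    by (rule Bochner_Integration.integrable_bound[OF i]) (use m le in auto)
  then show ?thesis using m by (simp add: Lp_def)
qed

lemma Lp_diff:
  assumes u: "u \<in> Lp p a b" and v: "v \<in> Lp p a b" and p: "0 < p"
  shows "(\<lambda>t. u t - v t) \<in> Lp p a b"
  using Lp_add[OF u Lp_scale[OF v p, of "-1"] p] by simp

lemma Lp_norm_eq_0_imp_AE:
  assumes u: "u \<in> Lp p a b" and 0: "Lp_norm p a b u = 0"
  shows "AE t in lebesgue_on {a..b}. u t = 0"
proof -
  have "(LINT t|lebesgue_on {a..b}. \<bar>u t\<bar> powr p) = 0"
    using 0 by (simp add: Lp_norm_def)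
  then have "AE t in lebesgue_on {a..b}. \<bar>u t\<bar> powr p = 0"
    using u by (subst (asm) integral_nonneg_eq_0_iff_AE) (auto simp: Lp_def)
  then show ?thesis by simp
qed

text \<open>
  Young's inequality makes the product integrable; applied to the factors normalised to have
  norm 1, it bounds the integral of the normalised product by \<open>1/p + 1/q = 1\<close>.
\<close>

lemma Hoelder_inequality:
  assumes p: "1 < p" "1 < q" "1 / p + 1 / q = 1"
    and u: "u \<in> Lp p a b" and v: "v \<in> Lp q a b"
  shows "integrable (lebesgue_on {a..b}) (\<lambda>t. u t * v t)"
    and "\<bar>LINT t|lebesgue_on {a..b}. u t * v t\<bar> \<le> Lp_norm p a b u * Lp_norm q a b v"
proof -
  let ?I = "integral\<^sup>L (lebesgue_on {a..b})"
  have m: "u \<in> borel_measurable (lebesgue_on {a..b})" "v \<in> borel_measurable (lebesgue_on {a..b})"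
    using u v by (auto dest: Lp_measurable)
  have ui: "integrable (lebesgue_on {a..b}) (\<lambda>t. \<bar>u t\<bar> powr p)"
    and vi: "integrable (lebesgue_on {a..b}) (\<lambda>t. \<bar>v t\<bar> powr q)"
    using u v by (auto simp: Lp_def)
  have young: "\<bar>x * y\<bar> \<le> \<bar>x\<bar> powr p / p + \<bar>y\<bar> powr q / q" for x y :: real
    using Youngs_inequality[OF p, of "\<bar>x\<bar>" "\<bar>y\<bar>"] by (simp add: abs_mult)
  show uvi: "integrable (lebesgue_on {a..b}) (\<lambda>t. u t * v t)"
  proof (rule Bochner_Integration.integrable_bound)
    show "integrable (lebesgue_on {a..b}) (\<lambda>t. \<bar>u t\<bar> powr p / p + \<bar>v t\<bar> powr q / q)"
      using ui vi by auto
    show "AE t in lebesgue_on {a..b}. norm (u t * v t) \<le> norm (\<bar>u t\<bar> powr p / p + \<bar>v t\<bar> powr q / q)"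
      using young by (intro AE_I2) (metis abs_ge_self order_trans real_norm_def)
  qed (use m in auto)
  define U V where "U = Lp_norm p a b u" and "V = Lp_norm q a b v"
  show "\<bar>?I (\<lambda>t. u t * v t)\<bar> \<le> Lp_norm p a b u * Lp_norm q a b v"
  proof (cases "U = 0 \<or> V = 0")
    case True
    then have "AE t in lebesgue_on {a..b}. u t * v t = 0"
      using Lp_norm_eq_0_imp_AE[OF u] Lp_norm_eq_0_imp_AE[OF v] by (auto simp: U_def V_def)
    then have "?I (\<lambda>t. u t * v t) = 0"
      by (rule integral_eq_zero_AE)
    then show ?thesis by simp
  next
    case False
    then have pos: "0 < U" "0 < V"
      using Lp_norm_nonneg[of p a b u] Lp_norm_nonneg[of q a b v] by (auto simp: U_def V_def less_le)
    have Up: "U powr p = ?I (\<lambda>t. \<bar>u t\<bar> powr p)" and Vq: "V powr q = ?I (\<lambda>t. \<bar>v t\<bar> powr q)"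
      using p by (auto simp: U_def V_def Lp_norm_def powr_powr)
    have "\<bar>?I (\<lambda>t. u t * v t)\<bar> \<le> ?I (\<lambda>t. \<bar>u t * v t\<bar>)"
      by (rule integral_abs_bound)
    also have "\<dots> \<le> ?I (\<lambda>t. U * V * (\<bar>u t\<bar> powr p / U powr p / p + \<bar>v t\<bar> powr q / V powr q / q))"
    proof (rule integral_mono)
      fix t
      have "\<bar>u t * v t\<bar> = U * V * \<bar>(u t / U) * (v t / V)\<bar>"
        using pos by (simp add: abs_mult)
      also have "\<dots> \<le> U * V * (\<bar>u t / U\<bar> powr p / p + \<bar>v t / V\<bar> powr q / q)"
        using pos by (intro mult_left_mono young) auto
      finally show "\<bar>u t * v t\<bar> \<le> U * V * (\<bar>u t\<bar> powr p / U powr p / p + \<bar>v t\<bar> powr q / V powr q / q)"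
        using pos by (simp add: powr_divide)
    qed (use ui vi uvi in auto)
    also have "\<dots> = U * V * (U powr p / U powr p / p + V powr q / V powr q / q)"
      using ui vi by (simp add: Up Vq)
    also have "\<dots> = U * V"
      using pos p by simp
    finally show ?thesis by (simp add: U_def V_def)
  qed
qed

section \<open>Measurability of the operator\<close>

text \<open>
  Rounding \<open>y\<close> down to a multiple of \<open>1/n\<close> leaves countably many values, so the composition is
  measurable piece by piece; continuity in the second variable lets \<open>n \<rightarrow> \<infinity>\<close>.
\<close>

lemma caratheodory_measurable_compose:
  fixes \<phi> :: "'a \<Rightarrow> real \<Rightarrow> real"
  assumes cont: "\<And>t. t \<in> space N \<Longrightarrow> continuous_on UNIV (\<phi> t)"
    and meas: "\<And>x. (\<lambda>t. \<phi> t x) \<in> borel_measurable N"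
    and y [measurable]: "y \<in> borel_measurable N"
  shows "(\<lambda>t. \<phi> t (y t)) \<in> borel_measurable N"
proof (rule borel_measurable_LIMSEQ_real)
  let ?r = "\<lambda>n x. of_int \<lfloor>real (Suc n) * x\<rfloor> / real (Suc n)"
  have r: "(\<lambda>n. ?r n x) \<longlonglongrightarrow> x" for x :: real
  proof (rule tendsto_sandwich)
    show "\<forall>\<^sub>F n in sequentially. x - 1 / real (Suc n) \<le> ?r n x"
    proof (intro always_eventually allI)
      fix n
      have "real (Suc n) * x - 1 \<le> of_int \<lfloor>real (Suc n) * x\<rfloor>"
        by linarith
      then have "(real (Suc n) * x - 1) / real (Suc n) \<le> ?r n x"
        by (intro divide_right_mono) auto
      then show "x - 1 / real (Suc n) \<le> ?r n x"
        by (simp add: diff_divide_distrib del: of_nat_Suc)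
    qed
    show "\<forall>\<^sub>F n in sequentially. ?r n x \<le> x"
      by (intro always_eventually allI) (simp add: field_simps)
    have "(\<lambda>n. x - 1 / real (Suc n)) \<longlonglongrightarrow> x - 0"
      by (intro tendsto_intros LIMSEQ_Suc lim_1_over_n)
    then show "(\<lambda>n. x - 1 / real (Suc n)) \<longlonglongrightarrow> x" by simp
  qed auto
  show "(\<lambda>n. \<phi> t (?r n (y t))) \<longlonglongrightarrow> \<phi> t (y t)" if "t \<in> space N" for t
    using cont[OF that] r[of "y t"]
    by (intro isCont_tendsto_compose[where g="\<phi> t"]) (auto simp: continuous_on_eq_continuous_at)
  show "(\<lambda>t. \<phi> t (?r n (y t))) \<in> borel_measurable N" for n
    by (rule measurable_compose_countable[where g="\<lambda>t. \<lfloor>real (Suc n) * y t\<rfloor>" and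
          f="\<lambda>i t. \<phi> t (of_int i / real (Suc n))"]) (use meas in measurable)
qed

lemma caratheodory_measurable:
  assumes "caratheodory a b \<phi>" "y \<in> borel_measurable (lebesgue_on {a..b})"
  shows "(\<lambda>t. \<phi> t (y t)) \<in> borel_measurable (lebesgue_on {a..b})"
  by (rule caratheodory_measurable_compose) (use assms in \<open>auto simp: caratheodory_def\<close>)

text \<open>
  Lebesgue measure on the plane is only the completion of the product measure, so the
  measurability half of Fubini's theorem is applied to Borel functions that agree almost
  everywhere with \<open>k\<close> and \<open>u\<close>. Almost every section of a plane null set is null, so the integral
  changes for a null set of parameters only, which completeness of Lebesgue measure ignores.
\<close>

lemma borel_measurable_kernel_integral:
  fixes k :: "real \<Rightarrow> real \<Rightarrow> real" and u :: "real \<Rightarrow> real"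
  assumes A: "A \<in> sets borel" and B: "B \<in> sets borel"
    and k: "(\<lambda>(t, s). k t s) \<in> borel_measurable (lebesgue_on (A \<times> B))"
    and u: "u \<in> borel_measurable (lebesgue_on B)"
  shows "(\<lambda>t. LINT s|lebesgue_on B. k t s * u s) \<in> borel_measurable (lebesgue_on A)"
proof -
  have AB: "A \<times> B \<in> sets lebesgue"
    using A B by (simp add: borel_Times)
  have "(\<lambda>x. if x \<in> A \<times> B then (\<lambda>(t, s). k t s) x else 0) \<in> borel_measurable lebesgue"
    using k AB by (simp add: borel_measurable_if)
  from completion_ex_borel_measurable_real[OF this] obtain k' where
    k': "k' \<in> borel_measurable lborel"
    and eqk: "AE x in lborel. (if x \<in> A \<times> B then (\<lambda>(t, s). k t s) x else 0) = k' x"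
    by blast
  have "(\<lambda>s. if s \<in> B then u s else 0) \<in> borel_measurable lebesgue"
    using u B by (simp add: borel_measurable_if)
  from completion_ex_borel_measurable_real[OF this] obtain u' where
    u': "u' \<in> borel_measurable lborel"
    and equ: "AE s in lborel. (if s \<in> B then u s else 0) = u' s"
    by blast
  have k'm [measurable]: "k' \<in> borel_measurable (lborel \<Otimes>\<^sub>M lborel)"
    using k' by (simp only: lborel_prod)
  have u'm [measurable]: "u' \<in> borel_measurable lborel" by (rule u')
  have "AE t in lborel. AE s in lborel. (if (t, s) \<in> A \<times> B then k t s else 0) = k' (t, s)"
    using lborel_pair.AE_pair[OF eqk[unfolded lborel_prod[symmetric]]] by (simp only: prod.case)
  then have "AE t in lborel. t \<in> A \<longrightarrow>
      (LINT s|lebesgue_on B. k t s * u s) = (LINT s|lborel. k' (t, s) * u' s)"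
  proof eventually_elim
    case (elim t)
    show ?case
    proof
      assume t: "t \<in> A"
      have "AE s in lborel. indicator B s *\<^sub>R (k t s * u s) = k' (t, s) * u' s"
        using elim equ by eventually_elim (use t in \<open>auto split: if_splits\<close>)
      then have eq: "AE s in lebesgue. indicator B s *\<^sub>R (k t s * u s) = k' (t, s) * u' s"
        by (rule AE_completion)
      have m: "(\<lambda>s. k' (t, s) * u' s) \<in> borel_measurable lborel"
        by measurable
      have ml: "(\<lambda>s. k' (t, s) * u' s) \<in> borel_measurable lebesgue"
        by (rule measurable_completion[OF m])
      have kul: "(\<lambda>s. indicator B s *\<^sub>R (k t s * u s)) \<in> borel_measurable lebesgue"
        by (rule borel_measurable_AE[OF ml]) (use eq in \<open>auto elim: eventually_mono\<close>)
      have "(LINT s|lebesgue_on B. k t s * u s) = (LINT s|lebesgue. indicator B s *\<^sub>R (k t s * u s))"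
        using B by (subst integral_restrict_space) auto
      also have "\<dots> = (LINT s|lebesgue. k' (t, s) * u' s)"
        by (rule integral_cong_AE[OF kul ml eq])
      also have "\<dots> = (LINT s|lborel. k' (t, s) * u' s)"
        by (rule integral_completion[OF m])
      finally show "(LINT s|lebesgue_on B. k t s * u s) = (LINT s|lborel. k' (t, s) * u' s)" .
    qed
  qed
  then have ae: "AE t in lebesgue. (if t \<in> A then LINT s|lborel. k' (t, s) * u' s else 0)
      = (if t \<in> A then LINT s|lebesgue_on B. k t s * u s else 0)"
    by (intro AE_completion) (auto elim: eventually_mono)
  have "(\<lambda>t. LINT s|lborel. k' (t, s) * u' s) \<in> borel_measurable lborel"
    by measurable
  then have "(\<lambda>t. if t \<in> A then LINT s|lborel. k' (t, s) * u' s else 0) \<in> borel_measurable lebesgue"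
    using A by (intro measurable_completion) (auto intro!: measurable_If_set)
  from borel_measurable_AE[OF this ae] show ?thesis
    using A by (simp add: borel_measurable_if)
qed

section \<open>Maps dominated by a weight of norm less than 1\<close>

text \<open>
  The tail of the telescoping series is bounded by the tail of a geometric one.
\<close>

lemma geometric_steps_converge:
  fixes x :: "nat \<Rightarrow> real"
  assumes c: "0 \<le> c" "c < 1"
    and step: "\<And>n. \<bar>x (Suc n) - x n\<bar> \<le> B * c ^ n"
  obtains l where "x \<longlonglongrightarrow> l" "\<And>n. \<bar>l - x n\<bar> \<le> B * c ^ n / (1 - c)"
proof -
  have geo: "(\<lambda>i. B * c ^ n * c ^ i) sums (B * c ^ n * (1 / (1 - c)))" for n
    using c by (intro sums_mult geometric_sums) auto
  have bound: "norm (x (Suc (i + n)) - x (i + n)) \<le> B * c ^ n * c ^ i" for i n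
    using step[of "i + n"] by (simp add: power_add mult_ac)
  have summ: "summable (\<lambda>i. x (Suc (i + n)) - x (i + n))" for n
    by (rule summable_comparison_test'[OF sums_summable[OF geo]]) (rule bound)
  define l where "l = x 0 + (\<Sum>i. x (Suc i) - x i)"
  have "(\<lambda>n. x 0 + (\<Sum>i<n. x (Suc i) - x i)) \<longlonglongrightarrow> l"
    unfolding l_def using summable_LIMSEQ[OF summ[of 0]] by (intro tendsto_intros) simp
  then have lim: "x \<longlonglongrightarrow> l"
    by (simp add: sum_lessThan_telescope)
  have "\<bar>l - x n\<bar> \<le> B * c ^ n / (1 - c)" for n
  proof -
    have "l - x n = (\<Sum>i. x (Suc (i + n)) - x (i + n))"
      using suminf_minus_initial_segment[OF summ[of 0], of n]
      by (simp add: l_def sum_lessThan_telescope)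
    also have "\<bar>\<dots>\<bar> \<le> (\<Sum>i. B * c ^ n * c ^ i)"
      using norm_suminf_le[OF bound sums_summable[OF geo], of n] by simp
    also have "\<dots> = B * c ^ n / (1 - c)"
      using sums_unique[OF geo[of n]] by simp
    finally show ?thesis .
  qed
  with lim that show thesis by blast
qed

text \<open>
  Domination by \<open>W\<close> at each point is stronger than contractivity in norm: single
  values, too, are controlled, up to the factor \<open>W t\<close>. Iterating,
  \<open>\<bar>x\<^sub>n\<^sub>+\<^sub>2(t) - x\<^sub>n\<^sub>+\<^sub>1(t)\<bar> \<le> W t d c\<^sup>n\<close> with \<open>c\<close>
  the norm of \<open>W\<close> and \<open>d\<close> that of \<open>x\<^sub>1 - x\<^sub>0\<close>. The iterates therefore converge at every point of
  the interval, and integrating the bound \<open>W t d c\<^sup>n / (1 - c)\<close> for the distance to the limit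
  shows both that the limit lies in the space and that convergence holds in norm.
\<close>

lemma Lp_fixed_point:
  assumes p: "0 < p"
    and T: "\<And>y. y \<in> Lp p a b \<Longrightarrow> T y \<in> Lp p a b"
    and W: "W \<in> Lp p a b" "\<And>t. t \<in> {a..b} \<Longrightarrow> 0 \<le> W t"
    and small: "Lp_norm p a b W < 1"
    and dom: "\<And>y z t. y \<in> Lp p a b \<Longrightarrow> z \<in> Lp p a b \<Longrightarrow> t \<in> {a..b} \<Longrightarrow>
      \<bar>T y t - T z t\<bar> \<le> W t * Lp_norm p a b (\<lambda>s. y s - z s)"
    and x0: "x 0 \<in> Lp p a b" and x_Suc: "\<And>n. x (Suc n) = T (x n)"
  obtains y where "y \<in> Lp p a b" "\<And>t. t \<in> {a..b} \<Longrightarrow> T y t = y t"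
    "\<And>z. z \<in> Lp p a b \<Longrightarrow> AE t in lebesgue_on {a..b}. z t = T z t \<Longrightarrow>
       AE t in lebesgue_on {a..b}. z t = y t"
    "\<And>n. x n \<in> Lp p a b"
    "(\<lambda>n. Lp_norm p a b (\<lambda>t. x n t - y t)) \<longlonglongrightarrow> 0"
proof -
  define c where "c = Lp_norm p a b W"
  have c: "0 \<le> c" "c < 1"
    using small by (auto simp: c_def)
  have norm_le: "Lp_norm p a b u \<le> B * c" and in_Lp: "u \<in> Lp p a b"
    if "u \<in> borel_measurable (lebesgue_on {a..b})" "0 \<le> B" "\<And>t. t \<in> {a..b} \<Longrightarrow> \<bar>u t\<bar> \<le> W t * B"
    for u B
  proof -
    have "AE t in lebesgue_on {a..b}. \<bar>u t\<bar> \<le> B * \<bar>W t\<bar>"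
      using that(3) W(2) by (intro AE_I2) (simp add: mult.commute)
    from Lp_dominated[OF W(1) p that(2,1) this]
    show "Lp_norm p a b u \<le> B * c" "u \<in> Lp p a b"
      by (auto simp: c_def)
  qed
  have contraction: "Lp_norm p a b (\<lambda>t. T y t - T z t) \<le> Lp_norm p a b (\<lambda>t. y t - z t) * c"
    if "y \<in> Lp p a b" "z \<in> Lp p a b" for y z
    using that Lp_measurable[OF Lp_diff[OF T T p]] by (intro norm_le dom) auto
  have x: "x n \<in> Lp p a b" for n
    by (induction n) (use x0 in \<open>auto simp: x_Suc intro: T\<close>)
  define d where "d = Lp_norm p a b (\<lambda>t. x 1 t - x 0 t)"
  have d: "0 \<le> d"
    by (simp add: d_def)
  have norm_step: "Lp_norm p a b (\<lambda>t. x (Suc n) t - x n t) \<le> d * c ^ n" for n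
  proof (induction n)
    case (Suc n)
    have "Lp_norm p a b (\<lambda>t. x (Suc (Suc n)) t - x (Suc n) t)
        \<le> Lp_norm p a b (\<lambda>t. x (Suc n) t - x n t) * c"
      using contraction[OF x[of "Suc n"] x[of n]] by (simp add: x_Suc)
    also have "\<dots> \<le> d * c ^ n * c"
      using Suc c by (intro mult_right_mono) auto
    finally show ?case by (simp add: mult_ac)
  qed (simp add: d_def)
  \<comment> \<open>The weight controls differences of values of \<open>T\<close>, hence of iterates from \<open>x 1\<close> on.\<close>
  have step: "\<bar>x (Suc (Suc n)) t - x (Suc n) t\<bar> \<le> W t * d * c ^ n" if "t \<in> {a..b}" for n t
  proof -
    have "\<bar>x (Suc (Suc n)) t - x (Suc n) t\<bar> \<le> W t * Lp_norm p a b (\<lambda>t. x (Suc n) t - x n t)"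
      using dom[OF x[of "Suc n"] x[of n] that] by (simp add: x_Suc)
    also have "\<dots> \<le> W t * (d * c ^ n)"
      using norm_step W(2)[OF that] by (intro mult_left_mono) auto
    finally show ?thesis by (simp add: mult_ac)
  qed
  have "\<exists>l. (\<lambda>n. x (Suc n) t) \<longlonglongrightarrow> l \<and> (\<forall>n. \<bar>l - x (Suc n) t\<bar> \<le> W t * d * c ^ n / (1 - c))"
    if t: "t \<in> {a..b}" for t
    using geometric_steps_converge[of c "\<lambda>n. x (Suc n) t" "W t * d", OF c step[OF t]] by metis
  then obtain y where y_lim: "\<And>t. t \<in> {a..b} \<Longrightarrow> (\<lambda>n. x (Suc n) t) \<longlonglongrightarrow> y t"
    and y_dist: "\<And>t n. t \<in> {a..b} \<Longrightarrow> \<bar>y t - x (Suc n) t\<bar> \<le> W t * d * c ^ n / (1 - c)"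
    by metis
  \<comment> \<open>The pointwise distance to the limit is \<open>W t\<close> times a null sequence that does not depend on \<open>t\<close>.\<close>
  define e where "e n = d * c ^ n / (1 - c)" for n
  have e: "0 \<le> e n" "e \<longlonglongrightarrow> 0" for n
  proof -
    show "0 \<le> e n"
      using c d by (auto simp: e_def)
    have "(\<lambda>n. d * c ^ n / (1 - c)) \<longlonglongrightarrow> d * 0 / (1 - c)"
      using c by (intro tendsto_intros LIMSEQ_power_zero) auto
    then show "e \<longlonglongrightarrow> 0" by (simp add: e_def[abs_def])
  qed
  have y_dist': "\<bar>y t - x (Suc n) t\<bar> \<le> W t * e n" if "t \<in> {a..b}" for t n
    using y_dist[OF that, of n] by (simp add: e_def mult_ac)
  have y_meas: "y \<in> borel_measurable (lebesgue_on {a..b})"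
    by (rule borel_measurable_LIMSEQ_real[of _ "\<lambda>n. x (Suc n)"])
      (use y_lim Lp_measurable[OF x] in auto)
  have diff_meas: "(\<lambda>t. y t - x (Suc n) t) \<in> borel_measurable (lebesgue_on {a..b})" for n
    using y_meas Lp_measurable[OF x] by auto
  have y: "y \<in> Lp p a b"
    using Lp_add[OF in_Lp[OF diff_meas e(1) y_dist'] x p, of 0 "Suc 0"] by simp
  have y_norm: "Lp_norm p a b (\<lambda>t. y t - x (Suc n) t) \<le> e n * c" for n
    by (rule norm_le[OF diff_meas e(1) y_dist'])
  have ec: "(\<lambda>n. e n * c) \<longlonglongrightarrow> 0"
    using tendsto_mult_right[OF e(2), of c] by simp
  have norm_lim: "(\<lambda>n. Lp_norm p a b (\<lambda>t. y t - x (Suc n) t)) \<longlonglongrightarrow> 0"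
    by (rule tendsto_sandwich[OF _ _ tendsto_const ec]) (auto simp: y_norm)
  have fp: "T y t = y t" if t: "t \<in> {a..b}" for t
  proof -
    have "(\<lambda>n. x (Suc (Suc n)) t - T y t) \<longlonglongrightarrow> 0"
    proof (rule Lim_null_comparison)
      show "\<forall>\<^sub>F n in sequentially. norm (x (Suc (Suc n)) t - T y t)
          \<le> W t * Lp_norm p a b (\<lambda>t. y t - x (Suc n) t)"
      proof (intro always_eventually allI)
        fix n
        show "norm (x (Suc (Suc n)) t - T y t) \<le> W t * Lp_norm p a b (\<lambda>t. y t - x (Suc n) t)"
          using dom[OF y x[of "Suc n"] t] by (simp add: x_Suc[of "Suc n"] abs_minus_commute)
      qed
      show "(\<lambda>n. W t * Lp_norm p a b (\<lambda>t. y t - x (Suc n) t)) \<longlonglongrightarrow> 0"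
        using tendsto_mult_left[OF norm_lim, of "W t"] by simp
    qed
    then have "(\<lambda>n. x (Suc (Suc n)) t) \<longlonglongrightarrow> T y t"
      by (simp add: LIM_zero_iff)
    with LIMSEQ_Suc[OF y_lim[OF t]] show ?thesis
      by (metis LIMSEQ_unique)
  qed
  have unique: "AE t in lebesgue_on {a..b}. z t = y t"
    if z: "z \<in> Lp p a b" and zT: "AE t in lebesgue_on {a..b}. z t = T z t" for z
  proof -
    let ?D = "Lp_norm p a b (\<lambda>t. z t - y t)"
    have zy: "(\<lambda>t. z t - y t) \<in> Lp p a b" and TT: "(\<lambda>t. T z t - T y t) \<in> Lp p a b"
      using z y p T by (auto intro: Lp_diff)
    have "AE t in lebesgue_on {a..b}. y t = T y t"
      using fp by (intro AE_I2) simp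
    with zT have "AE t in lebesgue_on {a..b}. \<bar>z t - y t\<bar> \<le> 1 * \<bar>T z t - T y t\<bar>"
      by eventually_elim simp
    from Lp_dominated(2)[OF TT p _ Lp_measurable[OF zy] this]
    have "?D \<le> Lp_norm p a b (\<lambda>t. T z t - T y t)" by simp
    also have "\<dots> \<le> ?D * c"
      by (rule contraction[OF z y])
    finally have "?D * (1 - c) \<le> 0"
      by (simp add: algebra_simps)
    then have "?D = 0"
      using c Lp_norm_nonneg[of p a b "\<lambda>t. z t - y t"]
      by (simp add: mult_le_0_iff)
    from Lp_norm_eq_0_imp_AE[OF zy this] show ?thesis by simp
  qed
  have "(\<lambda>n. Lp_norm p a b (\<lambda>t. x (Suc n) t - y t)) \<longlonglongrightarrow> 0"
    using norm_lim by (simp add: Lp_norm_def abs_minus_commute)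
  then have "(\<lambda>n. Lp_norm p a b (\<lambda>t. x n t - y t)) \<longlonglongrightarrow> 0"
    by (rule LIMSEQ_imp_Suc)
  from that[OF y fp unique x this] show thesis .
qed

section \<open>The functional-integral equation\<close>

theorem theorem2p4:
  fixes a b p q b1 b0 M L C :: real
    and f k g :: "real \<Rightarrow> real \<Rightarrow> real"
    and h1 M1 a0 :: "real \<Rightarrow> real"
  assumes ab: "a < b"
    and p: "1 < p" and pq: "1 / p + 1 / q = 1"
    and f_car: "caratheodory a b f"
    and k_meas: "(\<lambda>(t, s). k t s) \<in> borel_measurable (lebesgue_on ({a..b} \<times> {a..b}))"
    and A1_h1: "h1 \<in> Lp p a b" "\<forall>t\<in>{a..b}. 0 \<le> h1 t"
    and A1_b1: "0 \<le> b1"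
    and A1: "AE t in lebesgue_on {a..b}. \<forall>x. \<bar>f t x\<bar> \<le> h1 t + b1 * \<bar>x\<bar> powr (q / p)"
    and A2_k: "\<forall>t\<in>{a..b}. k t \<in> Lp q a b"
    and A2_M1: "M1 \<in> Lp p a b" "\<forall>t\<in>{a..b}. 0 \<le> M1 t"
    and A2: "\<forall>t\<in>{a..b}. (LINT s|lebesgue_on {a..b}. \<bar>k t s\<bar> powr q) powr (1 / q) \<le> M1 t"
    and A3_range: "\<forall>s\<in>{a..b}. \<forall>z. g s z \<in> {a..b}"
    and A3_car: "caratheodory a b g"
    and A3_a0: "a0 \<in> Lp p a b" "\<forall>s\<in>{a..b}. 0 \<le> a0 s"
    and A3_b0: "0 \<le> b0"
    and A3: "\<forall>s\<in>{a..b}. \<forall>z. \<bar>g s z\<bar> \<le> a0 s + b0 * \<bar>z\<bar>"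
    and H1: "0 < M" "\<forall>t\<in>{a..b}. \<forall>x1 x2. \<bar>f t x1 - f t x2\<bar> \<le> M * \<bar>x1 - x2\<bar>"
    and H2: "0 < L" "\<forall>s\<in>{a..b}. \<forall>z1 z2. \<bar>g s z1 - g s z2\<bar> \<le> L * \<bar>z1 - z2\<bar>"
    and C: "C = M * L"
    and contr: "(LINT s|lebesgue_on {a..b}. C powr p * M1 s powr p) < 1"
  shows "\<exists>y. Lp_solution p a b f k g y \<and>
           (\<forall>z. Lp_solution p a b f k g z \<longrightarrow> (AE t in lebesgue_on {a..b}. z t = y t)) \<and>
           (\<forall>n. successive_approx a b f k g n \<in> Lp p a b) \<and>
           (\<lambda>n. Lp_norm p a b (\<lambda>t. successive_approx a b f k g n t - y t)) \<longlonglongrightarrow> 0"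
proof -
  have q: "1 < q"
  proof -
    have "0 < 1 / p" "1 / p < 1"
      using p by auto
    then have q_inv: "0 < 1 / q" "1 / q < 1"
      using pq by linarith+
    then have "0 < q" by (simp only: zero_less_divide_1_iff)
    with q_inv(2) show ?thesis by simp
  qed
  have qp: "1 / q + 1 / p = 1" and p0: "0 < p"
    using p pq by auto
  let ?K = "\<lambda>u t. LINT s|lebesgue_on {a..b}. k t s * u s"
  have kernel_int: "integrable (lebesgue_on {a..b}) (\<lambda>s. k t s * u s)"
    and kernel_le: "\<bar>?K u t\<bar> \<le> M1 t * Lp_norm p a b u"
    if t: "t \<in> {a..b}" and u: "u \<in> Lp p a b" for t u
  proof -
    show "integrable (lebesgue_on {a..b}) (\<lambda>s. k t s * u s)"
      using Hoelder_inequality(1)[OF q p qp _ u] A2_k t by blast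
    have "\<bar>?K u t\<bar> \<le> Lp_norm q a b (k t) * Lp_norm p a b u"
      using Hoelder_inequality(2)[OF q p qp _ u] A2_k t by blast
    also have "\<dots> \<le> M1 t * Lp_norm p a b u"
      using A2 t by (intro mult_right_mono) (auto simp: Lp_norm_def)
    finally show "\<bar>?K u t\<bar> \<le> M1 t * Lp_norm p a b u" .
  qed
  have g_Lp: "(\<lambda>s. g s (y s)) \<in> Lp p a b" if y: "y \<in> Lp p a b" for y
  proof -
    have maj: "(\<lambda>s. a0 s + b0 * \<bar>y s\<bar>) \<in> Lp p a b"
      by (intro Lp_add Lp_scale Lp_abs A3_a0(1) y p0)
    have le: "AE s in lebesgue_on {a..b}. \<bar>g s (y s)\<bar> \<le> 1 * \<bar>a0 s + b0 * \<bar>y s\<bar>\<bar>"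
    proof (rule AE_I2)
      fix s
      assume "s \<in> space (lebesgue_on {a..b})"
      then have "\<bar>g s (y s)\<bar> \<le> a0 s + b0 * \<bar>y s\<bar>"
        using A3 by simp
      then show "\<bar>g s (y s)\<bar> \<le> 1 * \<bar>a0 s + b0 * \<bar>y s\<bar>\<bar>"
        by simp
    qed
    show ?thesis
      by (rule Lp_dominated(1)[OF maj p0 _ caratheodory_measurable[OF A3_car Lp_measurable[OF y]] le]) simp
  qed
  let ?T = "rhs_op a b f k g"
  have T_Lp: "?T y \<in> Lp p a b" if y: "y \<in> Lp p a b" for y
  proof -
    let ?u = "\<lambda>s. g s (y s)"
    let ?G = "Lp_norm p a b ?u"
    have "(\<lambda>t. ?K ?u t) \<in> borel_measurable (lebesgue_on {a..b})"
      by (rule borel_measurable_kernel_integral[OF _ _ k_meas Lp_measurable[OF g_Lp[OF y]]]) auto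
    then have meas: "?T y \<in> borel_measurable (lebesgue_on {a..b})"
      unfolding rhs_op_def by (rule caratheodory_measurable[OF f_car])
    \<comment> \<open>The growth bound at argument 0 gives \<open>\<bar>f t 0\<bar> \<le> h1 t\<close>, and the Lipschitz condition extends
      this to the linear majorant \<open>\<bar>f t x\<bar> \<le> h1 t + M \<bar>x\<bar>\<close>.\<close>
    have maj: "(\<lambda>t. h1 t + M * ?G * M1 t) \<in> Lp p a b"
      by (intro Lp_add Lp_scale A1_h1(1) A2_M1(1) p0)
    have le: "AE t in lebesgue_on {a..b}. \<bar>?T y t\<bar> \<le> 1 * \<bar>h1 t + M * ?G * M1 t\<bar>"
    proof -
      have "AE t in lebesgue_on {a..b}. t \<in> {a..b}"
        by (intro AE_I2) simp
      with A1 show ?thesis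
      proof eventually_elim
        case (elim t)
        have "\<bar>f t (?K ?u t) - f t 0\<bar> \<le> M * \<bar>?K ?u t\<bar>"
          using H1(2)[rule_format, OF elim(2), of "?K ?u t" 0] by simp
        also have "\<dots> \<le> M * (M1 t * ?G)"
          using H1(1) kernel_le[OF elim(2) g_Lp[OF y]] by (intro mult_left_mono) auto
        finally have "\<bar>f t (?K ?u t) - f t 0\<bar> \<le> M * ?G * M1 t"
          by (simp add: mult_ac)
        moreover have "\<bar>f t 0\<bar> \<le> h1 t"
          using elim(1)[rule_format, of 0] by simp
        ultimately show ?case
          by (simp add: rhs_op_def)
      qed
    qed
    show ?thesis
      by (rule Lp_dominated(1)[OF maj p0 _ meas le]) simp
  qed
  have T_dom: "\<bar>?T y t - ?T z t\<bar> \<le> C * M1 t * Lp_norm p a b (\<lambda>s. y s - z s)"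
    if y: "y \<in> Lp p a b" and z: "z \<in> Lp p a b" and t: "t \<in> {a..b}" for y z t
  proof -
    let ?w = "\<lambda>s. g s (y s) - g s (z s)"
    have w: "?w \<in> Lp p a b" and yz: "(\<lambda>s. y s - z s) \<in> Lp p a b"
      by (rule Lp_diff[OF g_Lp[OF y] g_Lp[OF z] p0], rule Lp_diff[OF y z p0])
    have w_le: "Lp_norm p a b ?w \<le> L * Lp_norm p a b (\<lambda>s. y s - z s)"
      using H2 by (intro Lp_dominated(2)[OF yz p0 _ Lp_measurable[OF w]] AE_I2) auto
    have "?K (\<lambda>s. g s (y s)) t - ?K (\<lambda>s. g s (z s)) t = ?K ?w t"
      using kernel_int[OF t g_Lp[OF y]] kernel_int[OF t g_Lp[OF z]]
      by (simp add: right_diff_distrib)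
    then have "\<bar>?T y t - ?T z t\<bar> \<le> M * \<bar>?K ?w t\<bar>"
      using H1(2)[rule_format, OF t, of "?K (\<lambda>s. g s (y s)) t" "?K (\<lambda>s. g s (z s)) t"]
      by (simp only: rhs_op_def)
    also have "\<dots> \<le> M * (M1 t * Lp_norm p a b ?w)"
      by (rule mult_left_mono[OF kernel_le[OF t w]]) (use H1(1) in simp)
    also have "\<dots> \<le> M * (M1 t * (L * Lp_norm p a b (\<lambda>s. y s - z s)))"
      by (intro mult_left_mono w_le) (use H1(1) A2_M1(2) t in auto)
    finally show ?thesis
      by (simp add: C mult_ac)
  qed
  have C0: "0 < C"
    using C H1(1) H2(1) by simp
  have small: "Lp_norm p a b (\<lambda>t. C * M1 t) < 1"
  proof -
    have eq: "(LINT t|lebesgue_on {a..b}. \<bar>C * M1 t\<bar> powr p)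
        = (LINT t|lebesgue_on {a..b}. C powr p * M1 t powr p)"
      using C0 A2_M1(2) by (intro Bochner_Integration.integral_cong) (auto simp: powr_mult abs_mult)
    have "0 \<le> (LINT t|lebesgue_on {a..b}. \<bar>C * M1 t\<bar> powr p)"
      by simp
    then have "Lp_norm p a b (\<lambda>t. C * M1 t) < 1 powr (1 / p)"
      using contr p0 unfolding Lp_norm_def eq by (intro powr_less_mono2) auto
    then show ?thesis by simp
  qed
  have W_nonneg: "0 \<le> C * M1 t" if "t \<in> {a..b}" for t
    using C0 A2_M1(2) that by simp
  let ?x = "successive_approx a b f k g"
  have x_0: "?x 0 \<in> Lp p a b" and x_Suc: "?x (Suc n) = ?T (?x n)" for n
    by simp_all
  obtain y where y: "y \<in> Lp p a b" "\<And>t. t \<in> {a..b} \<Longrightarrow> ?T y t = y t"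
    "\<And>z. z \<in> Lp p a b \<Longrightarrow> AE t in lebesgue_on {a..b}. z t = ?T z t \<Longrightarrow>
       AE t in lebesgue_on {a..b}. z t = y t"
    "\<And>n. ?x n \<in> Lp p a b" "(\<lambda>n. Lp_norm p a b (\<lambda>t. ?x n t - y t)) \<longlonglongrightarrow> 0"
    using Lp_fixed_point[where T = ?T and x = ?x, OF p0 T_Lp Lp_scale[OF A2_M1(1) p0]
        W_nonneg small T_dom x_0 x_Suc]
    by blast
  have "Lp_solution p a b f k g y"
    unfolding Lp_solution_def using y(1,2) by (auto intro!: AE_I2)
  with y(3-5) show ?thesis
    unfolding Lp_solution_def by blast
qed

end
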